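(* Let $\mathit{Var}$ be finite, $M$ a commutative complete quantale and $\sigma:\mathit{Var}\to M_1$. (a) There is a unique map $\alpha^{\mathbb N}_\sigma:\mathcal U_{\mathbb N}(\mathit{Var})\to M$ preserving arbitrary joins, tensor and unit with $\alpha^{\mathbb N}_\sigma(\hat v)=\sigma(v)$ for all $v$, namely $\alpha^{\mathbb N}_\sigma(\mathbb M)=\bigvee_{m\in\mathbb M}\bigotimes_v\sigma(v)^{m(v)}$ (affineness of $\sigma$ is the only requirement). (b) A map $\alpha_\sigma:\mathcal U(\mathit{Var})\to M$ preserving arbitrary joins, tensor and unit with $\alpha_\sigma(\hat v)=\sigma(v)$ for all $v$ exists if and only if $\sigma(v)\otimes\sigma(v)=\sigma(v)$ for every $v$, and in that case $\alpha_\sigma(\mathbb X)=\bigvee_{X\in\mathbb X}\bigotimes_{v\in X}\sigma(v)$.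
   Context: A commutative complete quantale $\langle M,\sqsubseteq,\bigvee,\otimes,1\rangle$ is a complete lattice with a commutative monoid $(\otimes,1)$ such that $\otimes$ distributes over arbitrary joins. $M_1=\{m\mid 1\sqsubseteq m\}$ (affine elements). $m^0=1$ and $m^n$ is the $n$-fold tensor power; empty tensors are $1$. $\mathcal U_{\mathbb N}(\mathit{Var})$ is the set of downsets of $(\mathbb N^{\mathit{Var}},\le)$ ordered by inclusion, with $\bigvee=\bigcup$, $\mathbb M\otimes\mathbb N={\downarrow}\{m+n\mid m\in\mathbb M,n\in\mathbb N\}$, $1={\downarrow}0$; generators $\hat v={\downarrow}e_v$, with $e_v$ the unit vector at $v$. $\mathcal U(\mathit{Var})$ is the set of downsets of $(\mathcal P(\mathit{Var}),\subseteq)$ ordered by inclusion, with $\bigvee=\bigcup$, $\mathbb X\otimes\mathbb Y={\downarrow}\{X\cup Y\mid X\in\mathbb X,Y\in\mathbb Y\}$, $1={\downarrow}\emptyset$; generators $\hat v={\downarrow}\{v\}$. *)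

theory Defs
  imports "HOL-Library.FuncSet"
begin

class comm_quantale = complete_lattice + comm_monoid_mult +
  assumes mult_Sup_distrib: "x * Sup A = (SUP a\<in>A. x * a)"

definition affine_elements :: "'m::comm_quantale set"
  where "affine_elements = {m. 1 \<le> m}"

text \<open>
  Downsets of a poset given as a subset \<open>P\<close> of an ordered type. When \<open>P\<close> carries a monoid
  operation \<open>f\<close>, the induced tensor of downsets is \<open>down_tensor P f\<close>.
\<close>

definition down :: "'a::order set \<Rightarrow> 'a set \<Rightarrow> 'a set"
  where "down P A = {x \<in> P. \<exists>a\<in>A. x \<le> a}"

definition downsets :: "'a::order set \<Rightarrow> 'a set set"
  where "downsets P = {A. A \<subseteq> P \<and> (\<forall>a\<in>A. \<forall>x\<in>P. x \<le> a \<longrightarrow> x \<in> A)}"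

definition down_tensor :: "'a::order set \<Rightarrow> ('a \<Rightarrow> 'a \<Rightarrow> 'a) \<Rightarrow> 'a set \<Rightarrow> 'a set \<Rightarrow> 'a set"
  where "down_tensor P f A B = down P {f a b | a b. a \<in> A \<and> b \<in> B}"

text \<open>
  The family \<open>S\<close> of downsets may be empty, so join preservation includes the bottom element.
\<close>

definition preserves_quantale ::
    "'a::order set \<Rightarrow> ('a \<Rightarrow> 'a \<Rightarrow> 'a) \<Rightarrow> 'a \<Rightarrow> ('a set \<Rightarrow> 'm::comm_quantale) \<Rightarrow> bool"
  where "preserves_quantale P f e \<alpha> \<longleftrightarrow>
    (\<forall>S. S \<subseteq> downsets P \<longrightarrow> \<alpha> (\<Union>S) = (SUP A\<in>S. \<alpha> A)) \<and>
    (\<forall>A\<in>downsets P. \<forall>B\<in>downsets P. \<alpha> (down_tensor P f A B) = \<alpha> A * \<alpha> B) \<and>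
    \<alpha> (down P {e}) = 1"

text \<open>
  The variables form a set \<open>V\<close>, possibly empty, inside an arbitrary type. Elements of
  \<open>\<nat>\<^sup>V\<close> are functions on the whole type vanishing outside \<open>V\<close>.
\<close>

definition exponents :: "'v set \<Rightarrow> ('v \<Rightarrow> nat) set"
  where "exponents V = {m. \<forall>v. v \<notin> V \<longrightarrow> m v = 0}"

definition UNat :: "'v set \<Rightarrow> ('v \<Rightarrow> nat) set set"
  where "UNat V = downsets (exponents V)"

definition UNat_gen :: "'v set \<Rightarrow> 'v \<Rightarrow> ('v \<Rightarrow> nat) set"
  where "UNat_gen V v = down (exponents V) {(\<lambda>w. if w = v then 1 else 0)}"

definition UNat_hom :: "'v set \<Rightarrow> (('v \<Rightarrow> nat) set \<Rightarrow> 'm::comm_quantale) \<Rightarrow> bool"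
  where "UNat_hom V \<alpha> \<longleftrightarrow> preserves_quantale (exponents V) (\<lambda>m n v. m v + n v) (\<lambda>_. 0) \<alpha>"

definition UPow :: "'v set \<Rightarrow> 'v set set set"
  where "UPow V = downsets (Pow V)"

definition UPow_gen :: "'v set \<Rightarrow> 'v \<Rightarrow> 'v set set"
  where "UPow_gen V v = down (Pow V) {{v}}"

definition UPow_hom :: "'v set \<Rightarrow> ('v set set \<Rightarrow> 'm::comm_quantale) \<Rightarrow> bool"
  where "UPow_hom V \<alpha> \<longleftrightarrow> preserves_quantale (Pow V) (\<union>) {} \<alpha>"

end

theory Submission imports Defs begin

text \<open>
  In both quantales every downset is the join of the principal downsets it contains, and the
  tensor of two principal downsets is principal. So a homomorphism is the same thing as a
  monotone monoid homomorphism on the underlying ordered monoid \<open>P\<close>, extended by joins.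
  For \<open>P = \<nat>\<^sup>V\<close> the generators determine a monoid homomorphism freely, and affineness of their
  images is what makes it monotone; for \<open>P = Pow V\<close> the relations \<open>{v} \<union> {v} = {v}\<close> force, and
  only require, idempotent images.
\<close>

section \<open>Commutative quantales\<close>

text \<open>For \<open>y \<le> z\<close> the join of \<open>{y, z}\<close> is \<open>z\<close>, so
  distributivity gives \<open>x * z = sup (x * y) (x * z)\<close>; commutativity handles the other
  factor.\<close>

lemma quantale_mult_mono:
  fixes a b c d :: "'m::comm_quantale"
  assumes "a \<le> b" "c \<le> d"
  shows "a * c \<le> b * d"
proof -
  have right: "x * y \<le> x * z" if "y \<le> z" for x y z :: 'm
    using mult_Sup_distrib[of x "{y, z}"] that by (simp add: sup_absorb2 le_iff_sup)
  show ?thesis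
    using right[OF assms(2), of a] right[OF assms(1), of d]
    by (metis mult.commute order_trans)
qed

lemma quantale_SUP_mult_SUP:
  fixes \<phi> :: "'a \<Rightarrow> 'm::comm_quantale"
  shows "(SUP a\<in>A. \<phi> a) * (SUP b\<in>B. \<psi> b) = (SUP a\<in>A. SUP b\<in>B. \<phi> a * \<psi> b)"
proof -
  have left: "(SUP a\<in>A. \<phi> a) * c = (SUP a\<in>A. \<phi> a * c)" for c
    using mult_Sup_distrib[of c "\<phi> ` A"] by (simp add: mult.commute image_image)
  have right: "c * (SUP b\<in>B. \<psi> b) = (SUP b\<in>B. c * \<psi> b)" for c
    using mult_Sup_distrib[of c "\<psi> ` B"] by (simp add: image_image)
  show ?thesis unfolding left unfolding right ..
qed

lemma quantale_one_le_power:
  fixes a :: "'m::comm_quantale"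
  assumes "1 \<le> a"
  shows "1 \<le> a ^ n"
proof (induction n)
  case (Suc n)
  then show ?case using quantale_mult_mono[OF assms Suc] by simp
qed simp

text \<open>The power \<open>a ^ n\<close> is \<open>a ^ m\<close> times \<open>a ^ (n - m)\<close>,
  and the second factor lies above 1.\<close>

lemma quantale_power_increasing:
  fixes a :: "'m::comm_quantale"
  assumes "1 \<le> a" "m \<le> n"
  shows "a ^ m \<le> a ^ n"
  using quantale_mult_mono[OF order_refl[of "a ^ m"] quantale_one_le_power[OF assms(1), of "n - m"]]
    assms(2) by (simp flip: power_add)

lemma quantale_prod_mono:
  fixes \<phi> :: "'a \<Rightarrow> 'm::comm_quantale"
  assumes "\<And>v. v \<in> A \<Longrightarrow> \<phi> v \<le> \<psi> v"
  shows "prod \<phi> A \<le> prod \<psi> A"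
  using assms by (induction A rule: infinite_finite_induct) (auto intro: quantale_mult_mono)

text \<open>The additional factors, those over \<open>B - A\<close>, are all at least 1.\<close>

lemma quantale_prod_mono2:
  fixes \<phi> :: "'a \<Rightarrow> 'm::comm_quantale"
  assumes "finite B" "A \<subseteq> B" "\<And>v. v \<in> B \<Longrightarrow> 1 \<le> \<phi> v"
  shows "prod \<phi> A \<le> prod \<phi> B"
proof -
  have "prod (\<lambda>v. 1) (B - A) \<le> prod \<phi> (B - A)"
    using assms(3) by (intro quantale_prod_mono) auto
  then have "prod \<phi> A * 1 \<le> prod \<phi> A * prod \<phi> (B - A)"
    by (intro quantale_mult_mono) auto
  then show ?thesis
    using prod.subset_diff[OF assms(2,1), of \<phi>] by (simp add: mult.commute)
qed

text \<open>The right-hand side counts the factors over \<open>A \<inter> B\<close> twice;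
  idempotence absorbs the second copy.\<close>

lemma prod_Un_idempotent:
  fixes \<phi> :: "'a \<Rightarrow> 'm::comm_monoid_mult"
  assumes "finite A" "finite B" "\<And>v. v \<in> A \<inter> B \<Longrightarrow> \<phi> v * \<phi> v = \<phi> v"
  shows "prod \<phi> (A \<union> B) = prod \<phi> A * prod \<phi> B"
proof -
  have "prod \<phi> (A \<inter> B) * prod \<phi> (A \<inter> B) = prod \<phi> (A \<inter> B)"
    using assms(3) by (simp flip: prod.distrib)
  moreover have "(i * a) * (i * b) = a * b * (i * i)" for i a b :: 'm
    by (simp add: mult_ac)
  moreover have "prod \<phi> A = prod \<phi> (A \<inter> B) * prod \<phi> (A - B)"
    and "prod \<phi> B = prod \<phi> (A \<inter> B) * prod \<phi> (B - A)"
    using prod.Int_Diff[OF assms(1), of \<phi> B] prod.Int_Diff[OF assms(2), of \<phi> A]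
    by (simp_all add: Int_commute)
  moreover have "prod \<phi> (A \<union> B) = prod \<phi> (A - B) * prod \<phi> (B - A) * prod \<phi> (A \<inter> B)"
    by (rule prod.union_diff2[OF assms(1,2)])
  ultimately show ?thesis by simp
qed

section \<open>Homomorphisms out of a quantale of downsets\<close>

lemma down_in_downsets: "down P A \<in> downsets P"
  by (auto simp: down_def downsets_def intro: order_trans)

lemma Union_in_downsets: "S \<subseteq> downsets P \<Longrightarrow> \<Union>S \<in> downsets P"
  unfolding downsets_def by blast

lemma downset_eq_Union_down:
  assumes "A \<in> downsets P"
  shows "A = (\<Union>a\<in>A. down P {a})"
  using assms by (auto simp: down_def downsets_def)

text \<open>By monotonicity \<open>f a b\<close> bounds every product of elements below
  \<open>a\<close> and \<open>b\<close>, and it is itself such a product.\<close>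

lemma down_tensor_principal:
  assumes "\<And>a b. a \<in> P \<Longrightarrow> b \<in> P \<Longrightarrow> f a b \<in> P"
    and "\<And>a b c d. a \<le> c \<Longrightarrow> b \<le> d \<Longrightarrow> f a b \<le> f c d"
    and "a \<in> P" "b \<in> P"
  shows "down_tensor P f (down P {a}) (down P {b}) = down P {f a b}"
proof
  show "down_tensor P f (down P {a}) (down P {b}) \<subseteq> down P {f a b}"
    by (auto simp: down_tensor_def down_def intro: order_trans assms(2))
  have "a \<in> down P {a}" "b \<in> down P {b}"
    using assms(3,4) by (auto simp: down_def)
  then show "down P {f a b} \<subseteq> down_tensor P f (down P {a}) (down P {b})"
    unfolding down_tensor_def by (auto simp: down_def)
qed

text \<open>Unions of downsets, tensors and the unit are again downsets, so only values there
  matter. This allows passing to an extensional restriction.\<close>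

lemma preserves_quantale_cong:
  assumes "\<And>A. A \<in> downsets P \<Longrightarrow> \<alpha> A = \<beta> A"
  shows "preserves_quantale P f e \<alpha> \<longleftrightarrow> preserves_quantale P f e \<beta>"
proof -
  have "(\<alpha> (\<Union>S) = (SUP A\<in>S. \<alpha> A)) \<longleftrightarrow> (\<beta> (\<Union>S) = (SUP A\<in>S. \<beta> A))" if "S \<subseteq> downsets P" for S
  proof -
    have "\<alpha> ` S = \<beta> ` S" using assms that by (intro image_cong) auto
    then show ?thesis using assms Union_in_downsets[OF that] by simp
  qed
  then show ?thesis
    using assms by (simp add: preserves_quantale_def down_tensor_def down_in_downsets)
qed

text \<open>Downward closure adds only elements whose values are dominated by values already
  present.\<close>

lemma SUP_down:
  fixes \<phi> :: "'a::order \<Rightarrow> 'm::complete_lattice"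
  assumes "mono_on P \<phi>" "A \<subseteq> P"
  shows "(SUP x\<in>down P A. \<phi> x) = (SUP a\<in>A. \<phi> a)"
proof (rule order_antisym)
  show "(SUP x\<in>down P A. \<phi> x) \<le> (SUP a\<in>A. \<phi> a)"
  proof (rule SUP_least)
    fix x assume "x \<in> down P A"
    then obtain a where "x \<in> P" "a \<in> A" "x \<le> a" by (auto simp: down_def)
    then show "\<phi> x \<le> (SUP a\<in>A. \<phi> a)"
      using assms by (intro SUP_upper2[of a]) (auto dest: mono_onD)
  qed
  show "(SUP a\<in>A. \<phi> a) \<le> (SUP x\<in>down P A. \<phi> x)"
    using assms(2) by (intro SUP_subset_mono) (auto simp: down_def)
qed

text \<open>The existence half. Monotonicity lets the downward closures in tensor and unit be
  ignored; distributivity over joins then reduces the tensor clause to multiplicativity of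
  \<open>\<phi>\<close>.\<close>

lemma preserves_quantale_SUP:
  fixes \<phi> :: "'a::order \<Rightarrow> 'm::comm_quantale"
  assumes "mono_on P \<phi>"
    and closed: "\<And>a b. a \<in> P \<Longrightarrow> b \<in> P \<Longrightarrow> f a b \<in> P" and "e \<in> P"
    and mult: "\<And>a b. a \<in> P \<Longrightarrow> b \<in> P \<Longrightarrow> \<phi> (f a b) = \<phi> a * \<phi> b" and "\<phi> e = 1"
  shows "preserves_quantale P f e (\<lambda>A. SUP a\<in>A. \<phi> a)"
  unfolding preserves_quantale_def
proof (intro conjI ballI allI impI)
  fix A B assume "A \<in> downsets P" "B \<in> downsets P"
  then have sub: "A \<subseteq> P" "B \<subseteq> P" by (auto simp: downsets_def)
  have "(SUP x\<in>down_tensor P f A B. \<phi> x) = (SUP x\<in>{f a b | a b. a \<in> A \<and> b \<in> B}. \<phi> x)"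
    unfolding down_tensor_def using sub closed by (intro SUP_down assms(1)) auto
  \<comment> \<open>Over a union of images the supremum becomes an iterated one, the form to which
    distributivity applies.\<close>
  also have "{f a b | a b. a \<in> A \<and> b \<in> B} = (\<Union>a\<in>A. f a ` B)"
    by auto
  also have "(SUP x\<in>(\<Union>a\<in>A. f a ` B). \<phi> x) = (SUP a\<in>A. SUP b\<in>B. \<phi> (f a b))"
    by (simp add: SUP_UNION image_image)
  also have "\<dots> = (SUP a\<in>A. SUP b\<in>B. \<phi> a * \<phi> b)"
    using sub by (intro SUP_cong refl mult) auto
  also have "\<dots> = (SUP a\<in>A. \<phi> a) * (SUP b\<in>B. \<phi> b)"
    by (rule quantale_SUP_mult_SUP[symmetric])
  finally show "(SUP x\<in>down_tensor P f A B. \<phi> x) = (SUP a\<in>A. \<phi> a) * (SUP b\<in>B. \<phi> b)" .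
next
  fix S show "(SUP a\<in>\<Union>S. \<phi> a) = (SUP A\<in>S. SUP a\<in>A. \<phi> a)"
    using SUP_UNION[of \<phi> "\<lambda>A. A" S] by simp
next
  show "(SUP a\<in>down P {e}. \<phi> a) = 1"
    using SUP_down[OF assms(1), of "{e}"] assms(3,5) by simp
qed

text \<open>The uniqueness half: \<open>\<alpha>\<close> is determined by its values on the points
  of \<open>P\<close>, embedded as principal downsets.\<close>

lemma preserves_quantale_eq_SUP:
  assumes "preserves_quantale P f e \<alpha>" "A \<in> downsets P"
  shows "\<alpha> A = (SUP a\<in>A. \<alpha> (down P {a}))"
proof -
  have "(\<lambda>a. down P {a}) ` A \<subseteq> downsets P"
    by (auto simp: down_in_downsets)
  then have "\<alpha> (\<Union>a\<in>A. down P {a}) = (SUP a\<in>A. \<alpha> (down P {a}))"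
    using assms(1) unfolding preserves_quantale_def by (metis image_image)
  then show ?thesis
    using downset_eq_Union_down[OF assms(2)] by simp
qed

text \<open>Together with the unit clause this makes \<open>\<alpha>\<close> a monoid homomorphism
  on points.\<close>

lemma preserves_quantale_principal_mult:
  assumes "preserves_quantale P f e \<alpha>"
    and "\<And>a b. a \<in> P \<Longrightarrow> b \<in> P \<Longrightarrow> f a b \<in> P"
    and "\<And>a b c d. a \<le> c \<Longrightarrow> b \<le> d \<Longrightarrow> f a b \<le> f c d"
    and "a \<in> P" "b \<in> P"
  shows "\<alpha> (down P {f a b}) = \<alpha> (down P {a}) * \<alpha> (down P {b})"
proof -
  have "\<alpha> (down_tensor P f (down P {a}) (down P {b})) = \<alpha> (down P {a}) * \<alpha> (down P {b})"
    using assms(1) by (simp add: preserves_quantale_def down_in_downsets)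
  then show ?thesis
    by (simp add: down_tensor_principal[OF assms(2-5)])
qed

section \<open>Downsets of exponent vectors\<close>

text \<open>The vector \<open>m\<close> is a finite sum of multiples of unit vectors, and
  \<open>\<alpha>\<close> turns sums into products.\<close>

lemma UNat_hom_principal:
  fixes \<alpha> :: "('v \<Rightarrow> nat) set \<Rightarrow> 'm::comm_quantale"
  assumes "finite V" "UNat_hom V \<alpha>" "\<And>v. v \<in> V \<Longrightarrow> \<alpha> (UNat_gen V v) = \<sigma> v"
    and "m \<in> exponents V"
  shows "\<alpha> (down (exponents V) {m}) = (\<Prod>v\<in>V. \<sigma> v ^ m v)"
proof -
  define g where "g m = \<alpha> (down (exponents V) {m})" for m
  have g_zero: "g (\<lambda>_. 0) = 1"
    using assms(2) by (simp add: UNat_hom_def preserves_quantale_def g_def)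
  have g_add: "g (\<lambda>v. m v + n v) = g m * g n" if "m \<in> exponents V" "n \<in> exponents V" for m n
    unfolding g_def
    by (rule preserves_quantale_principal_mult[OF assms(2)[unfolded UNat_hom_def]])
      (use that in \<open>auto simp: exponents_def le_fun_def add_mono\<close>)
  have g_multiple: "g (\<lambda>w. if w = v then n else 0) = \<sigma> v ^ n" if "v \<in> V" for v n
  proof (induction n)
    case 0
    then show ?case by (simp add: g_zero)
  next
    case (Suc n)
    have "(\<lambda>w. if w = v then Suc n else 0)
        = (\<lambda>w. (if w = v then 1 else 0) + (if w = v then n else 0))"
      by auto
    moreover have "g (\<lambda>w. if w = v then 1 else 0) = \<sigma> v"
      using assms(3)[OF that] by (simp add: g_def UNat_gen_def)
    ultimately show ?case
      using Suc that by (simp add: g_add exponents_def)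
  qed
  \<comment> \<open>Induction over the support: \<open>m\<close> is truncated to \<open>W\<close>,
    and each new variable adds a multiple of its unit vector.\<close>
  have "g (\<lambda>v. if v \<in> W then m v else 0) = (\<Prod>v\<in>W. \<sigma> v ^ m v)" if "W \<subseteq> V" for W
    using finite_subset[OF that assms(1)] that
  proof (induction W rule: finite_induct)
    case empty
    then show ?case by (simp add: g_zero)
  next
    case (insert v W)
    have "(\<lambda>w. if w \<in> insert v W then m w else 0)
        = (\<lambda>w. (if w = v then m v else 0) + (if w \<in> W then m w else 0))"
      using insert.hyps by auto
    moreover have "(\<lambda>w. if w = v then m v else 0) \<in> exponents V"
      "(\<lambda>w. if w \<in> W then m w else 0) \<in> exponents V"
      using insert.prems by (auto simp: exponents_def)
    ultimately show ?case
      using insert by (simp only: g_add) (simp add: g_multiple)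
  qed
  from this[of V] have "g (\<lambda>v. if v \<in> V then m v else 0) = (\<Prod>v\<in>V. \<sigma> v ^ m v)"
    by simp
  moreover have "(\<lambda>v. if v \<in> V then m v else 0) = m"
    using assms(4) by (auto simp: exponents_def)
  ultimately show ?thesis by (simp add: g_def)
qed

lemma UNat_hom_eq:
  assumes "finite V" "UNat_hom V \<alpha>" "\<And>v. v \<in> V \<Longrightarrow> \<alpha> (UNat_gen V v) = \<sigma> v" "M \<in> UNat V"
  shows "\<alpha> M = (SUP m\<in>M. \<Prod>v\<in>V. \<sigma> v ^ m v)"
proof -
  have "\<alpha> M = (SUP m\<in>M. \<alpha> (down (exponents V) {m}))"
    using assms(2,4) preserves_quantale_eq_SUP unfolding UNat_hom_def UNat_def by blast
  also have "\<dots> = (SUP m\<in>M. \<Prod>v\<in>V. \<sigma> v ^ m v)"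
    using assms(4)
    by (intro SUP_cong refl UNat_hom_principal[OF assms(1-3)]) (auto simp: UNat_def downsets_def)
  finally show ?thesis .
qed

text \<open>Affineness enters here: raising an exponent multiplies by further factors above
  1.\<close>

lemma mono_on_exponents_prod:
  fixes \<sigma> :: "'v \<Rightarrow> 'm::comm_quantale"
  assumes "\<sigma> \<in> V \<rightarrow> affine_elements"
  shows "mono_on (exponents V) (\<lambda>m. \<Prod>v\<in>V. \<sigma> v ^ m v)"
  using assms
  by (intro mono_onI quantale_prod_mono quantale_power_increasing)
    (auto simp: affine_elements_def le_fun_def)

lemma UNat_hom_SUP:
  fixes \<sigma> :: "'v \<Rightarrow> 'm::comm_quantale"
  assumes "\<sigma> \<in> V \<rightarrow> affine_elements"
  shows "UNat_hom V (\<lambda>M. SUP m\<in>M. \<Prod>v\<in>V. \<sigma> v ^ m v)"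
  unfolding UNat_hom_def
  by (intro preserves_quantale_SUP mono_on_exponents_prod assms)
    (auto simp: exponents_def power_add prod.distrib)

text \<open>The generator is the principal downset of a unit vector, so by monotonicity the supremum
  is the value at that vector.\<close>

lemma SUP_UNat_gen:
  fixes \<sigma> :: "'v \<Rightarrow> 'm::comm_quantale"
  assumes "finite V" "\<sigma> \<in> V \<rightarrow> affine_elements" "v \<in> V"
  shows "(SUP m\<in>UNat_gen V v. \<Prod>w\<in>V. \<sigma> w ^ m w) = \<sigma> v"
proof -
  have "{\<lambda>w. if w = v then 1 else 0} \<subseteq> exponents V"
    using assms(3) by (auto simp: exponents_def)
  from SUP_down[OF mono_on_exponents_prod[OF assms(2)] this]
  have "(SUP m\<in>UNat_gen V v. \<Prod>w\<in>V. \<sigma> w ^ m w) = (\<Prod>w\<in>V. \<sigma> w ^ (if w = v then 1 else 0))"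
    by (simp add: UNat_gen_def)
  also have "\<dots> = (\<Prod>w\<in>V. if w = v then \<sigma> w else 1)"
    by (intro prod.cong) auto
  finally show ?thesis using assms(1,3) by simp
qed

section \<open>Downsets of finite sets of variables\<close>

text \<open>A finite set is built up by unions with new singletons, each contributing one
  factor.\<close>

lemma UPow_hom_principal:
  fixes \<alpha> :: "'v set set \<Rightarrow> 'm::comm_quantale"
  assumes "finite V" "UPow_hom V \<alpha>" "\<And>v. v \<in> V \<Longrightarrow> \<alpha> (UPow_gen V v) = \<sigma> v" "Y \<subseteq> V"
  shows "\<alpha> (down (Pow V) {Y}) = (\<Prod>v\<in>Y. \<sigma> v)"
  using finite_subset[OF assms(4,1)] assms(4)
proof (induction Y rule: finite_induct)
  case empty
  then show ?case using assms(2) by (simp add: UPow_hom_def preserves_quantale_def)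
next
  case (insert v Y)
  have "\<alpha> (down (Pow V) {{v} \<union> Y}) = \<alpha> (down (Pow V) {{v}}) * \<alpha> (down (Pow V) {Y})"
    by (rule preserves_quantale_principal_mult[OF assms(2)[unfolded UPow_hom_def]])
      (use insert.prems in auto)
  then show ?case
    using insert assms(3)[of v] by (simp add: UPow_gen_def)
qed

lemma UPow_hom_eq:
  assumes "finite V" "UPow_hom V \<alpha>" "\<And>v. v \<in> V \<Longrightarrow> \<alpha> (UPow_gen V v) = \<sigma> v" "X \<in> UPow V"
  shows "\<alpha> X = (SUP Y\<in>X. \<Prod>v\<in>Y. \<sigma> v)"
proof -
  have "\<alpha> X = (SUP Y\<in>X. \<alpha> (down (Pow V) {Y}))"
    using assms(2,4) preserves_quantale_eq_SUP unfolding UPow_hom_def UPow_def by blast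
  also have "\<dots> = (SUP Y\<in>X. \<Prod>v\<in>Y. \<sigma> v)"
    using assms(4)
    by (intro SUP_cong refl UPow_hom_principal[OF assms(1-3)]) (auto simp: UPow_def downsets_def)
  finally show ?thesis .
qed

text \<open>Necessity of idempotence: the principal downset of \<open>{v}\<close> is idempotent
  under the tensor, and \<open>\<alpha>\<close> transports this.\<close>

lemma UPow_hom_gen_idempotent:
  assumes "UPow_hom V \<alpha>" "v \<in> V"
  shows "\<alpha> (UPow_gen V v) * \<alpha> (UPow_gen V v) = \<alpha> (UPow_gen V v)"
proof -
  have "\<alpha> (down (Pow V) {{v} \<union> {v}}) = \<alpha> (down (Pow V) {{v}}) * \<alpha> (down (Pow V) {{v}})"
    by (rule preserves_quantale_principal_mult[OF assms(1)[unfolded UPow_hom_def]])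
      (use assms(2) in auto)
  then show ?thesis by (simp add: UPow_gen_def)
qed

lemma mono_on_Pow_prod:
  fixes \<sigma> :: "'v \<Rightarrow> 'm::comm_quantale"
  assumes "finite V" "\<sigma> \<in> V \<rightarrow> affine_elements"
  shows "mono_on (Pow V) (\<lambda>Y. \<Prod>v\<in>Y. \<sigma> v)"
  using assms
  by (intro mono_onI quantale_prod_mono2) (auto simp: affine_elements_def intro: finite_subset)

text \<open>Sufficiency of idempotence: it makes the product over a union split even when the two
  sets overlap.\<close>

lemma UPow_hom_SUP:
  fixes \<sigma> :: "'v \<Rightarrow> 'm::comm_quantale"
  assumes "finite V" "\<sigma> \<in> V \<rightarrow> affine_elements" "\<forall>v\<in>V. \<sigma> v * \<sigma> v = \<sigma> v"
  shows "UPow_hom V (\<lambda>X. SUP Y\<in>X. \<Prod>v\<in>Y. \<sigma> v)"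
  unfolding UPow_hom_def using assms
  by (intro preserves_quantale_SUP mono_on_Pow_prod prod_Un_idempotent)
    (auto intro: finite_subset)

lemma SUP_UPow_gen:
  fixes \<sigma> :: "'v \<Rightarrow> 'm::comm_quantale"
  assumes "finite V" "\<sigma> \<in> V \<rightarrow> affine_elements" "v \<in> V"
  shows "(SUP Y\<in>UPow_gen V v. \<Prod>w\<in>Y. \<sigma> w) = \<sigma> v"
  using SUP_down[OF mono_on_Pow_prod[OF assms(1,2)], of "{{v}}"] assms(3)
  by (simp add: UPow_gen_def)

theorem proposition3:
  fixes V :: "'v set" and \<sigma> :: "'v \<Rightarrow> 'm::comm_quantale"
  assumes "finite V" and "\<sigma> \<in> V \<rightarrow> affine_elements"
  shows "((\<exists>!\<alpha>. \<alpha> \<in> extensional (UNat V) \<and> UNat_hom V \<alpha> \<and> (\<forall>v\<in>V. \<alpha> (UNat_gen V v) = \<sigma> v)) \<and>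
      (\<forall>\<alpha>. UNat_hom V \<alpha> \<and> (\<forall>v\<in>V. \<alpha> (UNat_gen V v) = \<sigma> v) \<longrightarrow>
        (\<forall>M\<in>UNat V. \<alpha> M = (SUP m\<in>M. \<Prod>v\<in>V. \<sigma> v ^ m v)))) \<and>
    (((\<exists>\<alpha>. UPow_hom V \<alpha> \<and> (\<forall>v\<in>V. \<alpha> (UPow_gen V v) = \<sigma> v)) \<longleftrightarrow>
        (\<forall>v\<in>V. \<sigma> v * \<sigma> v = \<sigma> v)) \<and>
      (\<forall>\<alpha>. UPow_hom V \<alpha> \<and> (\<forall>v\<in>V. \<alpha> (UPow_gen V v) = \<sigma> v) \<longrightarrow>
        (\<forall>X\<in>UPow V. \<alpha> X = (SUP Y\<in>X. \<Prod>v\<in>Y. \<sigma> v))))"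
proof (intro conjI)
  let ?\<alpha> = "\<lambda>M. SUP m\<in>M. \<Prod>v\<in>V. \<sigma> v ^ m v"
  have gen_UNat: "UNat_gen V v \<in> UNat V" for v
    by (simp add: UNat_gen_def UNat_def down_in_downsets)
  \<comment> \<open>The homomorphism conditions leave values outside \<open>UNat V\<close> free;
    \<open>extensional\<close> fixes them, so uniqueness is literal equality. The witness is the
    restricted supremum formula.\<close>
  show "\<exists>!\<alpha>. \<alpha> \<in> extensional (UNat V) \<and> UNat_hom V \<alpha> \<and> (\<forall>v\<in>V. \<alpha> (UNat_gen V v) = \<sigma> v)"
  proof (intro ex1I conjI ballI)
    show "restrict ?\<alpha> (UNat V) \<in> extensional (UNat V)" by simp
    show "UNat_hom V (restrict ?\<alpha> (UNat V))"
      using UNat_hom_SUP[OF assms(2)]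
        preserves_quantale_cong[of "exponents V" "restrict ?\<alpha> (UNat V)" ?\<alpha>]
      by (simp add: UNat_hom_def UNat_def)
    show "restrict ?\<alpha> (UNat V) (UNat_gen V v) = \<sigma> v" if "v \<in> V" for v
      using SUP_UNat_gen[OF assms that] by (simp add: gen_UNat)
  next
    fix \<alpha> assume "\<alpha> \<in> extensional (UNat V) \<and> UNat_hom V \<alpha> \<and> (\<forall>v\<in>V. \<alpha> (UNat_gen V v) = \<sigma> v)"
    then show "\<alpha> = restrict ?\<alpha> (UNat V)"
      by (intro extensionalityI[of _ "UNat V"]) (auto intro: UNat_hom_eq[OF assms(1)])
  qed
  show "\<forall>\<alpha>. UNat_hom V \<alpha> \<and> (\<forall>v\<in>V. \<alpha> (UNat_gen V v) = \<sigma> v) \<longrightarrow> (\<forall>M\<in>UNat V. \<alpha> M = ?\<alpha> M)"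
    using UNat_hom_eq[OF assms(1)] by blast
  \<comment> \<open>Left to right, idempotence of the generators passes to \<open>\<sigma>\<close>;
    right to left, the supremum formula is the witness.\<close>
  show "(\<exists>\<alpha>. UPow_hom V \<alpha> \<and> (\<forall>v\<in>V. \<alpha> (UPow_gen V v) = \<sigma> v)) \<longleftrightarrow> (\<forall>v\<in>V. \<sigma> v * \<sigma> v = \<sigma> v)"
    using UPow_hom_gen_idempotent[of V] UPow_hom_SUP[OF assms] SUP_UPow_gen[OF assms] by metis
  show "\<forall>\<alpha>. UPow_hom V \<alpha> \<and> (\<forall>v\<in>V. \<alpha> (UPow_gen V v) = \<sigma> v) \<longrightarrow>
      (\<forall>X\<in>UPow V. \<alpha> X = (SUP Y\<in>X. \<Prod>v\<in>Y. \<sigma> v))"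
    using UPow_hom_eq[OF assms(1)] by blast
qed

end
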